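(* Let $\alpha,\beta,\gamma>-1$, $\alpha\ne\beta$, $|\alpha-\beta|<1$. The coefficients of the type II Jacobi–Piñeiro stochastic matrix $P_{II}$ (see context) have the following limits: $$\lim_{n\to\infty}P_{II,2n+1,2n+2}=\lim_{n\to\infty}P_{II,2n,2n+1}=\frac{8}{27},\qquad\lim_{n\to\infty}P_{II,2n+1,2n+1}=\lim_{n\to\infty}P_{II,2n,2n}=\frac49,$$ $$\lim_{n\to\infty}P_{II,2n+1,2n}=\lim_{n\to\infty}P_{II,2n,2n-1}=\frac29,\qquad\lim_{n\to\infty}P_{II,2n+1,2n-1}=\lim_{n\to\infty}P_{II,2n,2n-2}=\frac1{27}.$$
   Context: The monic Jacobi–Piñeiro multiple orthogonal polynomials of type II $B_{(n,m)}$ are the monic polynomials of degree $n+m$ with $$\int_0^1B_{(n,m)}(x)x^{\alpha+j}(1-x)^\gamma\,dx=0,\ 0\le j\le n-1,\qquad\int_0^1B_{(n,m)}(x)x^{\beta+j}(1-x)^\gamma\,dx=0,\ 0\le j\le m-1.$$ On the step-line put $B^{(2n)}=B_{(n,n)}$ and $B^{(2n+1)}=B_{(n+1,n)}$, $n\in\mathbb N_0$. The Jacobi matrix $J=(J_{k,l})_{k,l\in\mathbb N_0}$ is defined by $xB^{(k)}(x)=\sum_lJ_{k,l}B^{(l)}(x)$. The type II Jacobi–Piñeiro stochastic matrix has entries $$P_{II,k,l}=\frac{B^{(l)}(1)}{B^{(k)}(1)}J_{k,l},$$ which vanish unless $k-2\le l\le k+1$. *)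

theory Defs
  imports "HOL-Analysis.Analysis" "HOL-Computational_Algebra.Polynomial"
begin

text \<open>
  The integrands have at most integrable endpoint singularities for parameters greater than
  \<open>- 1\<close>, so the Henstock-Kurzweil and Lebesgue integrals agree.
\<close>

definition is_jacobi_pineiro ::
    "real \<Rightarrow> real \<Rightarrow> real \<Rightarrow> nat \<Rightarrow> nat \<Rightarrow> real poly \<Rightarrow> bool" where
  "is_jacobi_pineiro \<alpha> \<beta> \<gamma> n m p \<longleftrightarrow>
     degree p = n + m \<and> lead_coeff p = 1 \<and>
     (\<forall>j<n. ((\<lambda>x. poly p x * x powr (\<alpha> + real j) * (1 - x) powr \<gamma>) has_integral 0) {0..1}) \<and>
     (\<forall>j<m. ((\<lambda>x. poly p x * x powr (\<beta> + real j) * (1 - x) powr \<gamma>) has_integral 0) {0..1})"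

definition jacobi_pineiro ::
    "real \<Rightarrow> real \<Rightarrow> real \<Rightarrow> nat \<Rightarrow> nat \<Rightarrow> real poly" where
  "jacobi_pineiro \<alpha> \<beta> \<gamma> n m = (THE p. is_jacobi_pineiro \<alpha> \<beta> \<gamma> n m p)"

definition step_line :: "real \<Rightarrow> real \<Rightarrow> real \<Rightarrow> nat \<Rightarrow> real poly" where
  "step_line \<alpha> \<beta> \<gamma> k =
     (if even k then jacobi_pineiro \<alpha> \<beta> \<gamma> (k div 2) (k div 2)
      else jacobi_pineiro \<alpha> \<beta> \<gamma> (k div 2 + 1) (k div 2))"

text \<open>
  Every row of the Jacobi matrix is finitely supported: it lists the coordinates of
  \<open>x B\<^sup>k(x)\<close> in the basis formed by the polynomials \<open>B\<^sup>l\<close>, which are monic of degree \<open>l\<close>.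
\<close>

definition jacobi_matrix :: "real \<Rightarrow> real \<Rightarrow> real \<Rightarrow> nat \<Rightarrow> nat \<Rightarrow> real" where
  "jacobi_matrix \<alpha> \<beta> \<gamma> =
     (THE J. \<forall>k. finite {l. J k l \<noteq> 0} \<and>
        [:0, 1:] * step_line \<alpha> \<beta> \<gamma> k =
          (\<Sum>l | J k l \<noteq> 0. smult (J k l) (step_line \<alpha> \<beta> \<gamma> l)))"

definition P_II :: "real \<Rightarrow> real \<Rightarrow> real \<Rightarrow> nat \<Rightarrow> nat \<Rightarrow> real" where
  "P_II \<alpha> \<beta> \<gamma> k l =
     poly (step_line \<alpha> \<beta> \<gamma> l) 1 / poly (step_line \<alpha> \<beta> \<gamma> k) 1 * jacobi_matrix \<alpha> \<beta> \<gamma> k l"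

end

theory Submission
  imports Defs
begin

text \<open>
  For a polynomial \<open>p\<close> of degree at most \<open>N\<close> and \<open>s > -1\<close>, expanding \<open>p\<close> in powers of \<open>1 - x\<close> gives
  \<open>\<integral>\<^sub>0\<^sup>1 p(x) x\<^sup>s (1 - x)\<^sup>\<gamma> dx = \<Gamma>(s + 1) \<Gamma>(\<gamma> + 1) / \<Gamma>(s + \<gamma> + 2 + N) \<cdot> T\<^sub>N p(s)\<close>
  with \<open>T\<^sub>N p\<close> a polynomial of degree at most \<open>N\<close>, leading coefficient \<open>p(1)\<close>, and
  \<open>T\<^sub>N\<^sub>+\<^sub>1 (x p)(s) = (s + 1) T\<^sub>N p(s + 1)\<close>. Orthogonality prescribes the zeros of \<open>T\<^sub>k B\<^sup>k\<close>, hence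
  \<open>T\<^sub>k B\<^sup>k = B\<^sup>k(1) q\<^sub>k\<close>, where \<open>q\<^sub>k(s) = \<Prod>\<^sub>i\<^sub><\<^sub>k (s - r\<^sub>i)\<close> and \<open>r\<close> is
  \<open>\<alpha>, \<beta>, \<alpha> + 1, \<beta> + 1, \<dots>\<close>. The recurrence for \<open>x B\<^sup>k\<close> becomes
  \<open>(s + 1) q\<^sub>k(s + 1) = \<Sum>\<^sub>l P\<^sub>k\<^sub>l q\<^sub>l(s) \<Prod>\<^sub>l\<^sub>\<le>\<^sub>j\<^sub>\<le>\<^sub>k (s + \<gamma> + 2 + j)\<close>. Evaluating it at
  \<open>r\<^sub>0, \<dots>, r\<^sub>k\<^sub>-\<^sub>3\<close> shows that \<open>P\<close> is banded, and after division by \<open>q\<^sub>k\<^sub>-\<^sub>2\<close> the values at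
  \<open>r\<^sub>k\<^sub>-\<^sub>2\<close>, \<open>- \<gamma> - 2 - k\<close> and \<open>-1\<close>, together with the row sum \<open>1\<close> (the value of the recurrence at
  \<open>x = 1\<close>), determine the four remaining entries and their limits, since \<open>r\<^sub>k / k \<longlongrightarrow> 1 / 2\<close>.
\<close>

section \<open>The numerator polynomial of the Mellin transform\<close>

lemma coeff_0_pcompose_reflect: "coeff (pcompose p [:1, -1 :: real:]) 0 = poly p 1"
  by (metis poly_0_coeff_0 poly_pcompose poly_pCons mult_zero_left add_0_right)

text \<open>This is \<open>T\<^sub>N p\<close>. The coefficients of
  \<open>pcompose p [:1, -1:]\<close> are those of \<open>p\<close> in powers of
  \<open>1 - x\<close>. The i-th power contributes a Beta integral with denominator
  \<open>Gamma (s + \<gamma> + 2 + i)\<close>, and the product over \<open>{i..<N}\<close> raises it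
  to the common denominator \<open>Gamma (s + \<gamma> + 2 + N)\<close>.\<close>

definition mellin_num :: "real \<Rightarrow> nat \<Rightarrow> real poly \<Rightarrow> real poly" where
  "mellin_num \<gamma> N p =
     (\<Sum>i\<le>N. smult (coeff (pcompose p [:1, -1:]) i * pochhammer (\<gamma> + 1) i)
        (\<Prod>j\<in>{i..<N}. [:\<gamma> + 2 + real j, 1:]))"

lemma mellin_num_0: "mellin_num \<gamma> 0 p = [:poly p 1:]"
  by (simp add: mellin_num_def coeff_0_pcompose_reflect)

lemma mellin_num_Suc:
  "mellin_num \<gamma> (Suc N) p = [:\<gamma> + 2 + real N, 1:] * mellin_num \<gamma> N p +
     [:coeff (pcompose p [:1, -1:]) (Suc N) * pochhammer (\<gamma> + 1) (Suc N):]"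
proof -
  have "(\<Prod>j\<in>{i..<Suc N}. [:\<gamma> + 2 + real j, 1:]) =
      [:\<gamma> + 2 + real N, 1:] * (\<Prod>j\<in>{i..<N}. [:\<gamma> + 2 + real j, 1:])" if "i \<le> N" for i
    using that by (simp add: prod.atLeastLessThan_Suc mult.commute)
  then have "(\<Sum>i\<le>N. smult (coeff (pcompose p [:1, -1:]) i * pochhammer (\<gamma> + 1) i)
        (\<Prod>j\<in>{i..<Suc N}. [:\<gamma> + 2 + real j, 1:])) = [:\<gamma> + 2 + real N, 1:] * mellin_num \<gamma> N p"
    unfolding mellin_num_def sum_distrib_left by (intro sum.cong) (auto simp: mult_smult_right simp del: mult_pCons_left)
  then show ?thesis
    unfolding mellin_num_def[of \<gamma> "Suc N"] by (simp del: mult_pCons_left prod.op_ivl_Suc pochhammer_Suc)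
qed

lemma mellin_num_add: "mellin_num \<gamma> N (p + q) = mellin_num \<gamma> N p + mellin_num \<gamma> N q"
  by (simp add: mellin_num_def pcompose_add sum.distrib[symmetric] smult_add_left[symmetric] ring_distribs)

lemma mellin_num_smult: "mellin_num \<gamma> N (smult c p) = smult c (mellin_num \<gamma> N p)"
  by (induction N) (simp_all add: mellin_num_0 mellin_num_Suc pcompose_smult smult_add_right algebra_simps del: mult_pCons_left)

lemma mellin_num_diff: "mellin_num \<gamma> N (p - q) = mellin_num \<gamma> N p - mellin_num \<gamma> N q"
  using mellin_num_add[of \<gamma> N p "smult (-1) q"] mellin_num_smult[of \<gamma> N "-1" q] by simp

lemma mellin_num_sum: "mellin_num \<gamma> N (\<Sum>l\<in>A. f l) = (\<Sum>l\<in>A. mellin_num \<gamma> N (f l))"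
  by (induction A rule: infinite_finite_induct) (auto simp: mellin_num_add, simp_all add: mellin_num_def)

lemma degree_pcompose_reflect: "degree (pcompose p [:1, -1 :: real:]) = degree p"
  by (simp add: degree_pcompose)

text \<open>Beyond the degree of \<open>p\<close> the constant added by
  \<open>mellin_num_Suc\<close> is zero, so each level only contributes its linear factor.\<close>

lemma mellin_num_raise:
  assumes "degree p \<le> l" "l \<le> N"
  shows "mellin_num \<gamma> N p = (\<Prod>j\<in>{l..<N}. [:\<gamma> + 2 + real j, 1:]) * mellin_num \<gamma> l p"
  using assms(2)
proof (induction N rule: dec_induct)
  case base
  then show ?case by simp
next
  case (step N)
  have "coeff (pcompose p [:1, -1:]) (Suc N) = 0"
    using assms(1) step.hyps by (intro coeff_eq_0) (simp add: degree_pcompose_reflect)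
  then show ?case
    using step by (simp add: mellin_num_Suc prod.atLeastLessThan_Suc mult_ac del: mult_pCons_left mult_pCons_right)
qed

text \<open>Multiplying by x moves the exponent from s to s + 1. The correction term replaces a
  degree bound, so that the induction on \<open>N\<close> can keep \<open>p\<close> fixed.\<close>

lemma mellin_num_times_X_aux:
  "poly (mellin_num \<gamma> (Suc N) ([:0, 1:] * p)) s =
     (s + 1) * poly (mellin_num \<gamma> N p) (s + 1) +
     coeff (pcompose p [:1, -1:]) (Suc N) * pochhammer (\<gamma> + 1) (Suc N)"
proof -
  \<comment> \<open>In powers of \<open>1 - x\<close>, the factor x is
    \<open>1 - (1 - x)\<close>.\<close>
  have c: "coeff (pcompose ([:0, 1:] * p) [:1, -1:]) (Suc i) =
      coeff (pcompose p [:1, -1:]) (Suc i) - coeff (pcompose p [:1, -1:]) i" for i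
    by (simp add: pcompose_mult pcompose_pCons)
  show ?thesis
  proof (induction N)
    case 0
    show ?case
      unfolding mellin_num_Suc mellin_num_0 c by (simp add: coeff_0_pcompose_reflect algebra_simps)
  next
    case (Suc N)
    show ?case
      unfolding mellin_num_Suc[of \<gamma> "Suc N"] c poly_add poly_mult Suc
      unfolding mellin_num_Suc[of \<gamma> N p] pochhammer_Suc[of _ "Suc N"]
      by (simp add: algebra_simps del: pochhammer_Suc)
  qed
qed

lemma mellin_num_times_X:
  assumes "degree p \<le> N"
  shows "poly (mellin_num \<gamma> (Suc N) ([:0, 1:] * p)) s = (s + 1) * poly (mellin_num \<gamma> N p) (s + 1)"
proof -
  have "coeff (pcompose p [:1, -1:]) (Suc N) = 0"
    using assms by (intro coeff_eq_0) (simp add: degree_pcompose_reflect)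
  then show ?thesis using mellin_num_times_X_aux[of \<gamma> N p s] by simp
qed

lemma degree_mellin_num: "degree (mellin_num \<gamma> N p) \<le> N"
proof (induction N)
  case (Suc N)
  have "degree ([:\<gamma> + 2 + real N, 1:] * mellin_num \<gamma> N p) \<le> Suc N"
    using Suc degree_mult_le[of "[:\<gamma> + 2 + real N, 1:]" "mellin_num \<gamma> N p"] by simp
  then show ?case
    unfolding mellin_num_Suc by (intro degree_add_le) auto
qed (simp add: mellin_num_0)

text \<open>Only the summand \<open>i = 0\<close> has N linear factors, and its coefficient is the
  value of \<open>p\<close> at 1.\<close>

lemma coeff_mellin_num: "coeff (mellin_num \<gamma> N p) N = poly p 1"
proof (induction N)
  case (Suc N)
  have "coeff (mellin_num \<gamma> N p) (Suc N) = 0"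
    using degree_mellin_num[of \<gamma> N p] by (intro coeff_eq_0) simp
  then show ?case using Suc by (simp add: mellin_num_Suc)
qed (simp add: mellin_num_0)

text \<open>The chosen point is the root of the last linear factor, which all summands but
  \<open>i = N\<close> contain. Evaluation there reads off the top coefficient.\<close>

lemma poly_mellin_num_node:
  "poly (mellin_num \<gamma> N p) (- \<gamma> - 1 - real N) = coeff (pcompose p [:1, -1:]) N * pochhammer (\<gamma> + 1) N"
proof (cases N)
  case 0
  then show ?thesis by (simp add: mellin_num_0 coeff_0_pcompose_reflect)
next
  case (Suc M)
  then show ?thesis by (simp add: mellin_num_Suc del: mult_pCons_left)
qed

text \<open>Evaluation at the root of the last linear factor kills the top coefficient, which lowers
  the degree bound; induction then finishes.\<close>

lemma mellin_num_eq_0: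
  assumes "\<gamma> > -1" "degree p \<le> N" "mellin_num \<gamma> N p = 0"
  shows "p = 0"
  using assms(2,3)
proof (induction N)
  case 0
  then obtain c where "p = [:c:]" by (auto elim: degree_eq_zeroE)
  with 0 show ?case by (simp add: mellin_num_0)
next
  case (Suc N)
  let ?a = "coeff (pcompose p [:1, -1:]) (Suc N)"
  have "?a * pochhammer (\<gamma> + 1) (Suc N) = 0"
    using poly_mellin_num_node[of \<gamma> "Suc N" p] Suc.prems by simp
  moreover have "pochhammer (\<gamma> + 1) (Suc N) > 0"
    using assms(1) by (intro pochhammer_pos) simp
  ultimately have a: "?a = 0" by (metis less_irrefl mult_eq_0_iff)
  have "degree p \<noteq> Suc N"
  proof
    assume "degree p = Suc N"
    then have "lead_coeff (pcompose p [:1, -1:]) = 0" using a by (simp add: degree_pcompose_reflect)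
    then have "pcompose p [:1, -1:] = 0" by simp
    then have "p = 0" by (simp add: pcompose_eq_0)
    with \<open>degree p = Suc N\<close> show False by simp
  qed
  with Suc.prems have "degree p \<le> N" by simp
  moreover have "mellin_num \<gamma> N p = 0"
    using Suc.prems(2) a unfolding mellin_num_Suc by (simp del: mult_pCons_left)
  ultimately show ?case using Suc.IH by blast
qed

lemma mellin_num_surj:
  assumes "\<gamma> > -1" "degree Q \<le> N"
  shows "\<exists>p. degree p \<le> N \<and> mellin_num \<gamma> N p = Q"
  using assms(2)
proof (induction N arbitrary: Q)
  case 0
  then obtain c where "Q = [:c:]" by (auto elim: degree_eq_zeroE)
  then show ?case by (intro exI[of _ "[:c:]"]) (simp add: mellin_num_0)
next
  case (Suc N)
  \<comment> \<open>The root of the linear factor in \<open>mellin_num_Suc\<close>. The quotient of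
    \<open>Q\<close> by that factor is reached by induction. The remainder comes from a multiple of
    \<open>(1 - x)^(N + 1)\<close>, which has no lower coefficients in powers of
    \<open>1 - x\<close>.\<close>
  define z where "z = - (\<gamma> + 2 + real N)"
  have deg: "degree (synthetic_div Q z) \<le> N"
    using Suc.prems by (simp add: degree_synthetic_div)
  obtain p where p: "degree p \<le> N" "mellin_num \<gamma> N p = synthetic_div Q z"
    using Suc.IH[OF deg] by blast
  define e where "e = ([:1, -1 :: real:]) ^ Suc N"
  define c where "c = poly Q z / pochhammer (\<gamma> + 1) (Suc N)"
  have "pcompose ([:1, -1 :: real:] ^ n) [:1, -1:] = monom 1 n" for n
  proof (induction n)
    case (Suc n)
    have "pcompose ([:1, -1 :: real:] ^ Suc n) [:1, -1:] = [:0, 1:] * pcompose ([:1, -1 :: real:] ^ n) [:1, -1:]"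
      unfolding power_Suc pcompose_mult by (simp add: pcompose_pCons)
    with Suc show ?case by (simp add: monom_Suc)
  qed (simp add: pcompose_1)
  then have ce: "coeff (pcompose e [:1, -1:]) i = (if i = Suc N then 1 else 0)" for i
    unfolding e_def by (simp del: power_Suc)
  have e0: "mellin_num \<gamma> N e = 0"
    unfolding mellin_num_def ce by (intro sum.neutral) auto
  have de: "degree e \<le> Suc N"
    unfolding e_def by (rule order.trans[OF degree_power_le]) simp
  have "pochhammer (\<gamma> + 1) (Suc N) > 0"
    using assms(1) by (intro pochhammer_pos) simp
  then have cc: "c * pochhammer (\<gamma> + 1) (Suc N) = poly Q z" unfolding c_def by simp
  have pN: "coeff (pcompose p [:1, -1:]) (Suc N) = 0"
    using p(1) by (intro coeff_eq_0) (simp add: degree_pcompose_reflect)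
  have zN: "\<gamma> + 2 + real N = - z" by (simp add: z_def)
  have "mellin_num \<gamma> (Suc N) (p + smult c e) = [:-z, 1:] * synthetic_div Q z + [:poly Q z:]"
    unfolding mellin_num_Suc mellin_num_add mellin_num_smult e0 p pcompose_add pcompose_smult
      coeff_add coeff_smult ce pN cc[symmetric] zN by (simp del: mult_pCons_left)
  also have "\<dots> = Q"
    using synthetic_div_correct'[of z Q] by simp
  finally show ?case
    using p(1) de by (intro exI[of _ "p + smult c e"]) (auto intro!: degree_add_le order.trans[OF degree_smult_le])
qed

text \<open>Expansion in powers of \<open>1 - x\<close> turns the integral into a finite sum of Beta
  values, which are then brought to a common Gamma denominator.\<close>

lemma has_integral_mellin_num:
  assumes "\<gamma> > -1" "s > -1" "degree p \<le> N"
  shows "((\<lambda>x. poly p x * x powr s * (1 - x) powr \<gamma>) has_integral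
     Gamma (s + 1) * Gamma (\<gamma> + 1) / Gamma (s + \<gamma> + 2 + real N) * poly (mellin_num \<gamma> N p) s) {0..1}"
proof -
  define a where "a = coeff (pcompose p [:1, -1:])"
  have p: "poly p x = (\<Sum>i\<le>N. a i * (1 - x) ^ i)" for x
  proof -
    have "poly p x = poly (pcompose p [:1, -1:]) (1 - x)" by (simp add: poly_pcompose)
    also have "\<dots> = (\<Sum>i\<le>N. a i * (1 - x) ^ i)"
      unfolding a_def using assms(3)
      by (subst poly_as_sum_of_monoms'[symmetric, of _ N])
        (simp_all add: degree_pcompose_reflect poly_sum poly_monom)
    finally show ?thesis .
  qed
  have B: "((\<lambda>x. a i * (x powr s * (1 - x) powr (\<gamma> + real i))) has_integral
      a i * Beta (s + 1) (\<gamma> + real i + 1)) {0..1}" for i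
    using has_integral_Beta_real[of "s + 1" "\<gamma> + real i + 1"] assms
    by (intro has_integral_mult_right) simp
  have "((\<lambda>x. \<Sum>i\<le>N. a i * (x powr s * (1 - x) powr (\<gamma> + real i))) has_integral
      (\<Sum>i\<le>N. a i * Beta (s + 1) (\<gamma> + real i + 1))) {0..1}"
    by (intro has_integral_sum B) simp
  moreover have "(\<Sum>i\<le>N. a i * (x powr s * (1 - x) powr (\<gamma> + real i))) =
      poly p x * x powr s * (1 - x) powr \<gamma>" if "x \<in> {0..1}" for x
  proof -
    \<comment> \<open>At \<open>x = 1\<close> both sides are 0, since \<open>0 powr\<close> any
      exponent is 0.\<close>
    have "(1 - x) powr (\<gamma> + real i) = (1 - x) ^ i * (1 - x) powr \<gamma>" for i
      using that by (cases "x = 1") (auto simp: powr_add powr_realpow)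
    then show ?thesis by (simp add: p sum_distrib_left mult_ac)
  qed
  moreover have "(\<Sum>i\<le>N. a i * Beta (s + 1) (\<gamma> + real i + 1)) =
      Gamma (s + 1) * Gamma (\<gamma> + 1) / Gamma (s + \<gamma> + 2 + real N) * poly (mellin_num \<gamma> N p) s"
  proof -
    have "Beta (s + 1) (\<gamma> + real i + 1) = Gamma (s + 1) * Gamma (\<gamma> + 1) / Gamma (s + \<gamma> + 2 + real N) *
        (pochhammer (\<gamma> + 1) i * (\<Prod>j\<in>{i..<N}. s + (\<gamma> + 2 + real j)))" if "i \<le> N" for i
    proof -
      have nz: "\<gamma> + 1 \<notin> \<int>\<^sub>\<le>\<^sub>0" "s + \<gamma> + 2 + real i \<notin> \<int>\<^sub>\<le>\<^sub>0"
        using assms by (auto elim!: nonpos_Ints_cases)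
      have 1: "Gamma (\<gamma> + real i + 1) = pochhammer (\<gamma> + 1) i * Gamma (\<gamma> + 1)"
      proof -
        have "Gamma (\<gamma> + 1) > 0" using assms(1) by (intro Gamma_real_pos) simp
        then show ?thesis using pochhammer_Gamma[OF nz(1), of i] by (simp add: add_ac)
      qed
      have "(\<Prod>j\<in>{i..<N}. s + (\<gamma> + 2 + real j)) = pochhammer (s + \<gamma> + 2 + real i) (N - i)"
        unfolding pochhammer_prod
        by (rule prod.reindex_bij_witness[of _ "\<lambda>j. j + i" "\<lambda>j. j - i"]) (use that in \<open>auto simp: of_nat_diff\<close>)
      also have "\<dots> = Gamma (s + \<gamma> + 2 + real N) / Gamma (s + \<gamma> + 2 + real i)"
      proof -
        have "s + \<gamma> + 2 + real i + real (N - i) = s + \<gamma> + 2 + real N" using that by simp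
        with pochhammer_Gamma[OF nz(2), of "N - i"] show ?thesis by metis
      qed
      finally have 2: "(\<Prod>j\<in>{i..<N}. s + (\<gamma> + 2 + real j)) =
          Gamma (s + \<gamma> + 2 + real N) / Gamma (s + \<gamma> + 2 + real i)" .
      have "Gamma (s + \<gamma> + 2 + real N) > 0"
        using assms by (intro Gamma_real_pos) simp
      moreover have 3: "s + 1 + (\<gamma> + real i + 1) = s + \<gamma> + 2 + real i" by simp
      ultimately show ?thesis unfolding Beta_def 3 1 2 by simp
    qed
    then show ?thesis
      unfolding mellin_num_def poly_sum sum_distrib_left
      by (intro sum.cong) (auto simp: a_def poly_prod algebra_simps)
  qed
  ultimately show ?thesis
    using has_integral_eq by (metis (no_types, lifting))
qed


section \<open>Interleaved orthogonality exponents and asymptotic scaling\<close>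

definition jp_node :: "real \<Rightarrow> real \<Rightarrow> nat \<Rightarrow> real" where
  "jp_node \<alpha> \<beta> i = (if even i then \<alpha> else \<beta>) + real (i div 2)"

definition jp_node_poly :: "real \<Rightarrow> real \<Rightarrow> nat \<Rightarrow> real poly" where
  "jp_node_poly \<alpha> \<beta> k = (\<Prod>i<k. [:- jp_node \<alpha> \<beta> i, 1:])"

lemma poly_jp_node_poly: "poly (jp_node_poly \<alpha> \<beta> k) s = (\<Prod>i<k. s - jp_node \<alpha> \<beta> i)"
  by (simp add: jp_node_poly_def poly_prod)

lemma degree_jp_node_poly: "degree (jp_node_poly \<alpha> \<beta> k) = k"
  by (simp add: jp_node_poly_def degree_prod_eq_sum_degree)

lemma coeff_jp_node_poly: "coeff (jp_node_poly \<alpha> \<beta> k) k = 1"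
  using lead_coeff_prod[of "\<lambda>i. [:- jp_node \<alpha> \<beta> i, 1:]" "{..<k}"] degree_jp_node_poly[of \<alpha> \<beta> k]
  by (simp add: jp_node_poly_def)

text \<open>Even indices \<open>2 * j\<close> carry the exponents of the first family and odd ones
  those of the second. Thus each step along the step-line adds exactly one node.\<close>

lemma ball_jp_node:
  "(\<forall>i<k. P (jp_node \<alpha> \<beta> i)) \<longleftrightarrow>
     (\<forall>j<(k + 1) div 2. P (\<alpha> + real j)) \<and> (\<forall>j<k div 2. P (\<beta> + real j))" (is "?L \<longleftrightarrow> ?R")
proof
  assume L: ?L
  have "P (\<alpha> + real j)" if "j < (k + 1) div 2" for j
    using L[rule_format, of "2 * j"] that by (simp add: jp_node_def)
  moreover have "P (\<beta> + real j)" if "j < k div 2" for j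
    using L[rule_format, of "2 * j + 1"] that by (simp add: jp_node_def)
  ultimately show ?R by blast
next
  assume R: ?R
  show ?L
  proof (intro allI impI)
    fix i assume "i < k"
    then show "P (jp_node \<alpha> \<beta> i)"
      using R by (cases "even i") (auto simp: jp_node_def elim!: evenE oddE)
  qed
qed

text \<open>Supplies the limits of the linear factors in the formulas for the entries, once these
  are scaled by the index.\<close>

lemma tendsto_over_n_linear:
  assumes "(\<lambda>n. f n / real n) \<longlonglongrightarrow> a"
  shows "(\<lambda>n. (x * f n + y * real n + c) / real n) \<longlonglongrightarrow> x * a + y"
proof -
  have "(\<lambda>n. x * (f n / real n) + y + c / real n) \<longlonglongrightarrow> x * a + y + 0"
    by (intro tendsto_intros assms lim_const_over_n)
  moreover have "\<forall>\<^sub>F n in sequentially. x * (f n / real n) + y + c / real n = (x * f n + y * real n + c) / real n"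
    using eventually_gt_at_top[of 0] by eventually_elim (simp add: field_simps)
  ultimately show ?thesis by (simp add: filterlim_cong)
qed

section \<open>Step-line polynomials: existence, uniqueness and transform\<close>

locale jacobi_pineiro_params =
  fixes \<alpha> \<beta> \<gamma> :: real
  assumes gt: "\<alpha> > -1" "\<beta> > -1" "\<gamma> > -1"
    and distinct: "\<alpha> \<noteq> \<beta>" "\<bar>\<alpha> - \<beta>\<bar> < 1"
begin

abbreviation node where "node \<equiv> jp_node \<alpha> \<beta>"
abbreviation q where "q \<equiv> jp_node_poly \<alpha> \<beta>"
abbreviation B where "B \<equiv> step_line \<alpha> \<beta> \<gamma>"
abbreviation J where "J \<equiv> jacobi_matrix \<alpha> \<beta> \<gamma>"
abbreviation P where "P \<equiv> P_II \<alpha> \<beta> \<gamma>"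

lemma node_gt: "node i > -1"
  using gt by (simp add: jp_node_def add_strict_increasing2)

text \<open>A coincidence between the two families would make \<open>\<alpha> - \<beta>\<close> a
  nonzero integer of absolute value less than 1.\<close>

lemma inj_node: "inj node"
proof (rule injI)
  fix i j assume eq: "node i = node j"
  have "\<alpha> + real a \<noteq> \<beta> + real b" for a b
  proof
    assume "\<alpha> + real a = \<beta> + real b"
    then have "\<alpha> - \<beta> = of_int (int b - int a)" by simp
    moreover from this distinct(2) have "\<bar>int b - int a\<bar> < 1" by linarith
    ultimately show False using distinct(1) by simp
  qed
  then have "\<beta> + real b \<noteq> \<alpha> + real a" for a b by metis
  with \<open>\<And>a b. \<alpha> + real a \<noteq> \<beta> + real b\<close> have "(even i \<longleftrightarrow> even j) \<and> i div 2 = j div 2"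
    using eq by (cases "even i"; cases "even j") (simp_all add: jp_node_def)
  then show "i = j" by (metis even_two_times_div_two odd_two_times_div_two_succ)
qed

lemma poly_q_neg_nonzero: "s \<le> -1 \<Longrightarrow> poly (q k) s \<noteq> 0"
  using node_gt by (auto simp: poly_jp_node_poly) (metis less_le_not_le)

text \<open>For positive \<open>k\<close> the point lies to the left of -1, hence of all nodes; for
  \<open>k = 0\<close> the polynomial is the constant 1.\<close>

lemma poly_q_node_nonzero: "poly (q k) (- \<gamma> - 1 - real k) \<noteq> 0"
proof (cases k)
  case (Suc n)
  then show ?thesis using gt(3) by (intro poly_q_neg_nonzero) simp
qed (simp add: poly_jp_node_poly)

lemma poly_q_node: "poly (q k) (node i) = 0 \<longleftrightarrow> i < k"
  using inj_node by (auto simp: poly_jp_node_poly inj_eq)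

text \<open>Node \<open>i + 2\<close> is node \<open>i\<close> plus 1, so the shifted product loses
  only its first two factors.\<close>

lemma poly_q_shift:
  "poly (q (Suc (Suc k))) (s + 1) = (s + 1 - \<alpha>) * (s + 1 - \<beta>) * poly (q k) s"
  unfolding poly_jp_node_poly prod.lessThan_Suc_shift
  by (simp add: jp_node_def algebra_simps cong: if_cong)

text \<open>The Gamma prefactor is positive, so an integral vanishes exactly when the transform has
  a zero at the exponent.\<close>

lemma is_jacobi_pineiro_step:
  "is_jacobi_pineiro \<alpha> \<beta> \<gamma> ((k + 1) div 2) (k div 2) p \<longleftrightarrow>
     degree p = k \<and> lead_coeff p = 1 \<and> (\<forall>i<k. poly (mellin_num \<gamma> k p) (node i) = 0)"
proof (cases "degree p = k")
  case True
  have iff: "((\<lambda>x. poly p x * x powr s * (1 - x) powr \<gamma>) has_integral 0) {0..1} \<longleftrightarrow>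
      poly (mellin_num \<gamma> k p) s = 0" if "s > -1" for s
  proof -
    define c where "c = Gamma (s + 1) * Gamma (\<gamma> + 1) / Gamma (s + \<gamma> + 2 + real k)"
    have "Gamma (s + 1) > 0" "Gamma (\<gamma> + 1) > 0" "Gamma (s + \<gamma> + 2 + real k) > 0"
      using that gt by (auto intro!: Gamma_real_pos)
    then have "c > 0" by (simp add: c_def)
    have I: "((\<lambda>x. poly p x * x powr s * (1 - x) powr \<gamma>) has_integral c * poly (mellin_num \<gamma> k p) s) {0..1}"
      unfolding c_def using that True gt(3) by (intro has_integral_mellin_num) auto
    show ?thesis
    proof
      assume "((\<lambda>x. poly p x * x powr s * (1 - x) powr \<gamma>) has_integral 0) {0..1}"
      from has_integral_unique[OF this I] \<open>c > 0\<close> show "poly (mellin_num \<gamma> k p) s = 0" by simp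
    next
      assume "poly (mellin_num \<gamma> k p) s = 0"
      with I show "((\<lambda>x. poly p x * x powr s * (1 - x) powr \<gamma>) has_integral 0) {0..1}" by simp
    qed
  qed
  have "\<alpha> + real j > -1" "\<beta> + real j > -1" for j
    using gt by (simp_all add: add_strict_increasing2)
  note iff' = this[THEN iff]
  moreover have "(k + 1) div 2 + k div 2 = k" by presburger
  ultimately show ?thesis
    unfolding is_jacobi_pineiro_def iff' ball_jp_node[where P = "\<lambda>s. poly (mellin_num \<gamma> k p) s = 0"]
    using True by simp
qed (auto simp: is_jacobi_pineiro_def)

text \<open>Both sides have degree at most \<open>k\<close> and the same coefficient at
  \<open>k\<close>, and they agree at \<open>k\<close> distinct nodes.\<close>

lemma mellin_num_eq_q:
  assumes "\<forall>i<k. poly (mellin_num \<gamma> k p) (node i) = 0"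
  shows "mellin_num \<gamma> k p = smult (poly p 1) (q k)"
proof (rule poly_eqI_degree_lead_coeff[where A = "node ` {..<k}" and n = k])
  show "k \<le> card (node ` {..<k})"
    using inj_node by (simp add: card_image inj_on_subset)
qed (use assms in \<open>auto simp: coeff_mellin_num coeff_jp_node_poly degree_mellin_num degree_jp_node_poly poly_q_node\<close>)

text \<open>For existence, a preimage of \<open>q k\<close> under the transform is normalised; its
  degree is exactly \<open>k\<close> because \<open>q k\<close> is nonzero at the point that reads
  off the top coefficient.\<close>

lemma ex1_is_jacobi_pineiro: "\<exists>!p. is_jacobi_pineiro \<alpha> \<beta> \<gamma> ((k + 1) div 2) (k div 2) p"
proof (rule ex_ex1I)
  let ?s = "- \<gamma> - 1 - real k"
  note q_nz = poly_q_node_nonzero[of k]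
  obtain p where p: "degree p \<le> k" "mellin_num \<gamma> k p = q k"
    using mellin_num_surj[OF gt(3), of "q k" k] by (auto simp: degree_jp_node_poly)
  have "coeff (pcompose p [:1, -1:]) k \<noteq> 0"
    using poly_mellin_num_node[of \<gamma> k p] p q_nz by auto
  then have "degree p = k"
    using p(1) le_degree[of "pcompose p [:1, -1:]" k] by (simp add: degree_pcompose_reflect)
  moreover have "p \<noteq> 0"
    using \<open>coeff (pcompose p [:1, -1:]) k \<noteq> 0\<close> by auto
  ultimately show "\<exists>p. is_jacobi_pineiro \<alpha> \<beta> \<gamma> ((k + 1) div 2) (k div 2) p"
    unfolding is_jacobi_pineiro_step
    by (intro exI[of _ "smult (1 / lead_coeff p) p"]) (auto simp: mellin_num_smult p(2) poly_q_node)
next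
  fix p p' :: "real poly"
  let ?s = "- \<gamma> - 1 - real k" and ?d = "p - p'"
  note q_nz = poly_q_node_nonzero[of k]
  assume "is_jacobi_pineiro \<alpha> \<beta> \<gamma> ((k + 1) div 2) (k div 2) p"
    and "is_jacobi_pineiro \<alpha> \<beta> \<gamma> ((k + 1) div 2) (k div 2) p'"
  then have p: "degree p = k" "lead_coeff p = 1" "degree p' = k" "lead_coeff p' = 1"
    and z: "\<forall>i<k. poly (mellin_num \<gamma> k ?d) (node i) = 0"
    unfolding is_jacobi_pineiro_step mellin_num_diff by auto
  have top: "coeff (pcompose r [:1, -1:]) k = (-1) ^ k" if "degree r = k" "lead_coeff r = 1" for r :: "real poly"
    using lead_coeff_comp[of "[:1, -1:]" r] that by (simp add: degree_pcompose_reflect)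
  have eq: "mellin_num \<gamma> k ?d = smult (poly ?d 1) (q k)"
    by (rule mellin_num_eq_q[OF z])
  \<comment> \<open>The top coefficients of the two reflected monic polynomials are both
    \<open>(-1) ^ k\<close> and cancel, while \<open>q k\<close> is nonzero at the evaluation
    point.\<close>
  have "poly ?d 1 = 0"
    using poly_mellin_num_node[of \<gamma> k ?d] q_nz top[of p] top[of p'] p unfolding eq
    by (simp add: pcompose_diff)
  then have "mellin_num \<gamma> k ?d = 0" using eq by simp
  moreover have "degree ?d \<le> k" using p by (intro degree_diff_le) auto
  ultimately have "?d = 0" using mellin_num_eq_0[OF gt(3)] by blast
  then show "p = p'" by simp
qed

lemma is_jacobi_pineiro_step_line: "is_jacobi_pineiro \<alpha> \<beta> \<gamma> ((k + 1) div 2) (k div 2) (B k)"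
proof -
  have "B k = jacobi_pineiro \<alpha> \<beta> \<gamma> ((k + 1) div 2) (k div 2)"
    by (auto simp: step_line_def)
  then show ?thesis
    unfolding jacobi_pineiro_def using theI'[OF ex1_is_jacobi_pineiro] by simp
qed

lemma degree_B: "degree (B k) = k" and lead_coeff_B: "coeff (B k) k = 1"
  and mellin_num_B: "mellin_num \<gamma> k (B k) = smult (poly (B k) 1) (q k)"
  using is_jacobi_pineiro_step_line[of k] mellin_num_eq_q[of k "B k"]
  unfolding is_jacobi_pineiro_step by auto

text \<open>A zero at 1 would annihilate the whole transform, hence \<open>B k\<close> itself. This
  makes the quotients in \<open>P_II\<close> meaningful.\<close>

lemma B_1_nonzero: "poly (B k) 1 \<noteq> 0"
proof
  assume "poly (B k) 1 = 0"
  then have "B k = 0"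
    using mellin_num_B[of k] mellin_num_eq_0[OF gt(3), of "B k" k] degree_B by simp
  then show False using lead_coeff_B[of k] by simp
qed

section \<open>The Jacobi matrix as coordinates in the step-line basis\<close>

lemma B_span: "degree p \<le> n \<Longrightarrow> \<exists>c. p = (\<Sum>l\<le>n. smult (c l) (B l))"
proof (induction n arbitrary: p)
  case 0
  then obtain c where "p = [:c:]" by (auto elim: degree_eq_zeroE)
  moreover have "B 0 = [:1:]"
    using degree_B[of 0] lead_coeff_B[of 0] by (auto elim: degree_eq_zeroE)
  ultimately show ?case by (intro exI[of _ "\<lambda>_. c"]) simp
next
  case (Suc n)
  let ?r = "p - smult (coeff p (Suc n)) (B (Suc n))"
  have "degree ?r \<le> Suc n"
    using Suc.prems by (intro degree_diff_le) (auto simp: degree_B)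
  moreover have "coeff ?r (Suc n) = 0" by (simp add: lead_coeff_B)
  ultimately have "degree ?r \<le> n"
    by (metis degree_0 eq_zero_or_degree_less le_Suc_eq less_Suc_eq_le zero_le)
  then obtain c where c: "?r = (\<Sum>l\<le>n. smult (c l) (B l))" using Suc.IH by blast
  show ?case
    by (intro exI[of _ "c(Suc n := coeff p (Suc n))"]) (use c in \<open>simp add: algebra_simps\<close>)
qed

lemma B_independent:
  "(\<Sum>l<n. smult (d l) (B l)) = 0 \<Longrightarrow> l < n \<Longrightarrow> d l = 0"
proof (induction n)
  case (Suc n)
  have "coeff (\<Sum>l<n. smult (d l) (B l)) n = 0"
    unfolding coeff_sum by (intro sum.neutral) (auto simp: coeff_eq_0 degree_B)
  moreover have "coeff (\<Sum>l<Suc n. smult (d l) (B l)) n = 0" using Suc.prems by simp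
  ultimately have "d n = 0" by (simp add: lead_coeff_B)
  with Suc show ?case by (auto simp: less_Suc_eq)
qed simp

text \<open>Coordinates in the basis of the \<open>B l\<close> exist and are unique, so the definite
  description in \<open>jacobi_matrix\<close> is attained.\<close>

lemma jacobi_matrix_expansion:
  "[:0, 1:] * B k = (\<Sum>l\<le>Suc k. smult (J k l) (B l))" (is ?thesis1)
  and jacobi_matrix_upper: "l > Suc k \<Longrightarrow> J k l = 0"
proof -
  have sum_supp: "(\<Sum>l | c l \<noteq> 0. smult (c l) (B l)) = (\<Sum>l<n. smult (c l) (B l))"
    if "\<forall>l. c l \<noteq> 0 \<longrightarrow> l < n" for c n
    by (rule sum.mono_neutral_left) (use that in auto)
  define Q where "Q J \<longleftrightarrow> (\<forall>k. finite {l. J k l \<noteq> 0} \<and>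
      [:0, 1:] * B k = (\<Sum>l | J k l \<noteq> 0. smult (J k l) (B l)))" for J
  have "\<exists>c. [:0, 1:] * B k = (\<Sum>l\<le>Suc k. smult (c l) (B l))" for k
    using degree_mult_le[of "[:0, 1:]" "B k"] by (intro B_span) (simp add: degree_B)
  then obtain c where c: "[:0, 1:] * B k = (\<Sum>l\<le>Suc k. smult (c k l) (B l))" for k by metis
  \<comment> \<open>The witnesses \<open>c k l\<close> are arbitrary for \<open>l > Suc k\<close>;
    cutting them off there gives finitely supported rows.\<close>
  define C where "C k l = (if l \<le> Suc k then c k l else 0)" for k l
  have QC: "Q C"
    unfolding Q_def
  proof (intro allI conjI)
    fix k
    show "finite {l. C k l \<noteq> 0}"
      by (rule finite_subset[of _ "{..Suc k}"]) (auto simp: C_def)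
    have "(\<Sum>l | C k l \<noteq> 0. smult (C k l) (B l)) = (\<Sum>l<Suc (Suc k). smult (C k l) (B l))"
      by (rule sum_supp) (auto simp: C_def)
    also have "\<dots> = (\<Sum>l\<le>Suc k. smult (c k l) (B l))"
      unfolding lessThan_Suc_atMost by (intro sum.cong) (auto simp: C_def)
    finally show "[:0, 1:] * B k = (\<Sum>l | C k l \<noteq> 0. smult (C k l) (B l))" using c by simp
  qed
  have uniq: "J' = C" if "Q J'" for J'
  proof (intro ext)
    fix k l
    have "finite ({l. J' k l \<noteq> 0} \<union> {l. C k l \<noteq> 0} \<union> {l})"
      using that QC by (auto simp: Q_def)
    then obtain n where n: "\<forall>l\<in>{l. J' k l \<noteq> 0} \<union> {l. C k l \<noteq> 0} \<union> {l}. l < n"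
      using finite_nat_set_iff_bounded by blast
    have "(\<Sum>l<n. smult (J' k l) (B l)) = (\<Sum>l<n. smult (C k l) (B l))"
      using sum_supp[of "J' k" n] sum_supp[of "C k" n] n that QC unfolding Q_def by auto
    then have "(\<Sum>l<n. smult (J' k l - C k l) (B l)) = 0"
      by (simp add: smult_diff_left sum_subtractf)
    then show "J' k l = C k l" using B_independent[of "\<lambda>l. J' k l - C k l" n l] n by auto
  qed
  have "J = (THE J. Q J)" unfolding jacobi_matrix_def Q_def ..
  also have "\<dots> = C" using QC uniq by (rule the_equality)
  finally have J: "J = C" .
  show ?thesis1 unfolding J c by (intro sum.cong) (auto simp: C_def)
  show "l > Suc k \<Longrightarrow> J k l = 0" unfolding J by (simp add: C_def)
qed

section \<open>The transformed recurrence and the band structure\<close>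

lemma P_row_sum: "(\<Sum>l\<le>Suc k. P k l) = 1"
proof -
  have "poly (B k) 1 = (\<Sum>l\<le>Suc k. J k l * poly (B l) 1)"
    using arg_cong[OF jacobi_matrix_expansion[of k], of "\<lambda>p. poly p 1"]
    by (simp add: poly_sum del: sum.atMost_Suc)
  moreover have "(\<Sum>l\<le>Suc k. P k l) = (\<Sum>l\<le>Suc k. J k l * poly (B l) 1) / poly (B k) 1"
    unfolding P_II_def sum_divide_distrib by (intro sum.cong) auto
  ultimately show ?thesis using B_1_nonzero[of k] by simp
qed

text \<open>Apply the transform at level \<open>k + 1\<close> to the expansion of
  \<open>x B k\<close>. The values at 1 that appear with each \<open>q l\<close> are exactly the
  weights turning \<open>J\<close> into \<open>P\<close>.\<close>

lemma mellin_recurrence: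
  "(s + 1) * poly (q k) (s + 1) =
     (\<Sum>l\<le>Suc k. P k l * (\<Prod>j\<in>{l..<Suc k}. s + \<gamma> + 2 + real j) * poly (q l) s)"
proof -
  have "poly (B k) 1 * ((s + 1) * poly (q k) (s + 1)) = poly (mellin_num \<gamma> (Suc k) ([:0, 1:] * B k)) s"
    by (subst mellin_num_times_X) (simp_all add: degree_B mellin_num_B)
  also have "\<dots> = (\<Sum>l\<le>Suc k. J k l * poly (mellin_num \<gamma> (Suc k) (B l)) s)"
    unfolding jacobi_matrix_expansion mellin_num_sum mellin_num_smult by (simp add: poly_sum del: sum.atMost_Suc)
  also have "\<dots> = (\<Sum>l\<le>Suc k. J k l * ((\<Prod>j\<in>{l..<Suc k}. s + \<gamma> + 2 + real j) * (poly (B l) 1 * poly (q l) s)))"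
  proof (intro sum.cong refl)
    fix l assume "l \<in> {..Suc k}"
    then have "mellin_num \<gamma> (Suc k) (B l) = (\<Prod>j\<in>{l..<Suc k}. [:\<gamma> + 2 + real j, 1:]) * mellin_num \<gamma> l (B l)"
      by (intro mellin_num_raise) (auto simp: degree_B)
    then show "J k l * poly (mellin_num \<gamma> (Suc k) (B l)) s =
        J k l * ((\<Prod>j\<in>{l..<Suc k}. s + \<gamma> + 2 + real j) * (poly (B l) 1 * poly (q l) s))"
      by (simp add: mellin_num_B poly_prod add_ac del: prod.op_ivl_Suc)
  qed
  also have "\<dots> = poly (B k) 1 *
      (\<Sum>l\<le>Suc k. P k l * (\<Prod>j\<in>{l..<Suc k}. s + \<gamma> + 2 + real j) * poly (q l) s)"
    unfolding sum_distrib_left P_II_def using B_1_nonzero by (intro sum.cong) auto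
  finally show ?thesis using B_1_nonzero[of k] by simp
qed

text \<open>At \<open>s = node l\<close> the terms beyond \<open>l\<close> vanish through
  \<open>q\<close>, the earlier ones by induction, and the left side through
  \<open>poly_q_shift\<close>. The surviving factor of \<open>P k l\<close> is nonzero.\<close>

lemma P_lower:
  assumes "l + 2 < k"
  shows "P k l = 0"
  using assms
proof (induction l rule: less_induct)
  case (less l)
  define k' where "k' = k - 2"
  have k: "k = Suc (Suc k')" "l < k'" using less.prems by (auto simp: k'_def)
  have "(\<Sum>i\<le>Suc k. P k i * (\<Prod>j\<in>{i..<Suc k}. node l + \<gamma> + 2 + real j) * poly (q i) (node l)) =
      (\<Sum>i\<in>{l}. P k i * (\<Prod>j\<in>{i..<Suc k}. node l + \<gamma> + 2 + real j) * poly (q i) (node l))"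
  proof (rule sum.mono_neutral_right)
    show "\<forall>i\<in>{..Suc k} - {l}. P k i * (\<Prod>j\<in>{i..<Suc k}. node l + \<gamma> + 2 + real j) * poly (q i) (node l) = 0"
      using less by (auto simp: poly_q_node linorder_not_less) 
  qed (use less.prems in auto)
  moreover have "poly (q k) (node l + 1) = 0"
    unfolding k(1) poly_q_shift using k(2) by (simp add: poly_q_node)
  ultimately have "P k l * (\<Prod>j\<in>{l..<Suc k}. node l + \<gamma> + 2 + real j) * poly (q l) (node l) = 0"
    using mellin_recurrence[of "node l" k] by simp
  moreover have "node l + \<gamma> + 2 + real j \<noteq> 0" for j
    using node_gt[of l] gt(3) of_nat_0_le_iff[of j, where ?'a = real] by linarith
  moreover have "poly (q l) (node l) \<noteq> 0" by (simp add: poly_q_node)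
  ultimately show ?case by (simp del: prod.op_ivl_Suc)
qed


lemma poly_q_Suc: "poly (q (Suc k)) s = poly (q k) s * (s - node k)"
  by (simp add: poly_jp_node_poly)

text \<open>Both sides of the recurrence for row \<open>K + 2\<close> contain the factor
  \<open>poly (q K) s\<close>; cancelling it leaves a cubic identity with four unknown
  entries.\<close>

lemma band_identity:
  fixes K :: nat and s :: real
  defines "\<sigma> \<equiv> s + \<gamma> + 2 + real K"
  assumes "poly (q K) s \<noteq> 0"
  shows "(s + 1) * (s + 1 - \<alpha>) * (s + 1 - \<beta>) =
     P (K + 2) K * \<sigma> * (\<sigma> + 1) * (\<sigma> + 2) +
     P (K + 2) (K + 1) * (\<sigma> + 1) * (\<sigma> + 2) * (s - node K) +
     P (K + 2) (K + 2) * (\<sigma> + 2) * (s - node K) * (s - node (K + 1)) +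
     P (K + 2) (K + 3) * (s - node K) * (s - node (K + 1)) * (s - node (K + 2))" (is "_ = ?R")
proof -
  let ?f = "\<lambda>l. P (K + 2) l * (\<Prod>j\<in>{l..<Suc (K + 2)}. s + \<gamma> + 2 + real j) * poly (q l) s"
  have "(\<Sum>l\<le>Suc (K + 2). ?f l) = (\<Sum>l\<in>{K, K + 1, K + 2, K + 3}. ?f l)"
    by (rule sum.mono_neutral_right) (auto simp: P_lower)
  also have "\<dots> = poly (q K) s * ?R"
    unfolding \<sigma>_def
    by (simp add: poly_q_Suc numeral_3_eq_3 numeral_2_eq_2 prod.atLeastLessThan_Suc algebra_simps)
  finally have "(s + 1) * poly (q (K + 2)) (s + 1) = poly (q K) s * ?R"
    using mellin_recurrence[of s "K + 2"] by metis
  moreover have "(s + 1) * poly (q (K + 2)) (s + 1) = poly (q K) s * ((s + 1) * (s + 1 - \<alpha>) * (s + 1 - \<beta>))"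
    using poly_q_shift[of K s] by simp
  ultimately show ?thesis using assms(2) by simp
qed

lemma P_band_sum: "P (K + 2) K + P (K + 2) (K + 1) + P (K + 2) (K + 2) + P (K + 2) (K + 3) = 1"
proof -
  have "(\<Sum>l\<le>Suc (K + 2). P (K + 2) l) = (\<Sum>l\<in>{K, K + 1, K + 2, K + 3}. P (K + 2) l)"
    by (rule sum.mono_neutral_right) (auto simp: P_lower)
  then show ?thesis using P_row_sum[of "K + 2"] by simp
qed

section \<open>Limits of the four entries in a row\<close>

lemma tendsto_node: "(\<lambda>K. node (K + i) / real K) \<longlonglongrightarrow> 1 / 2"
proof -
  \<comment> \<open>A crude bound, uniform in \<open>K\<close>: the integer division by 2 loses at
    most 1/2.\<close>
  define C where "C = \<bar>\<alpha>\<bar> + \<bar>\<beta>\<bar> + real i + 1"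
  have bound: "\<bar>node (K + i) - real K / 2\<bar> \<le> C" for K
  proof -
    have "2 * ((K + i) div 2) \<le> K + i" "K + i \<le> 2 * ((K + i) div 2) + 1" by presburger+
    then have "2 * real ((K + i) div 2) \<le> real K + real i" "real K + real i \<le> 2 * real ((K + i) div 2) + 1"
      by linarith+
    then show ?thesis unfolding jp_node_def C_def by (auto simp: abs_if)
  qed
  have "\<forall>\<^sub>F K in sequentially. norm (node (K + i) / real K - 1 / 2) \<le> C / real K"
    using eventually_gt_at_top[of 0]
  proof eventually_elim
    case (elim K)
    then have "node (K + i) / real K - 1 / 2 = (node (K + i) - real K / 2) / real K" by (simp add: field_simps)
    then show ?case using bound[of K] by (simp add: divide_right_mono)
  qed
  moreover have "(\<lambda>K. C / real K) \<longlonglongrightarrow> 0" by (rule lim_const_over_n)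
  ultimately have "(\<lambda>K. node (K + i) / real K - 1 / 2) \<longlonglongrightarrow> 0"
    by (rule Lim_null_comparison)
  then show ?thesis by (rule LIM_zero_cancel)
qed

text \<open>At \<open>s = node K\<close>, which is not a zero of \<open>q K\<close>, every other
  entry has the factor \<open>s - node K\<close>. The limit is the cube of (1/2) / (3/2).\<close>

lemma P_limit_lower2: "(\<lambda>K. P (K + 2) K) \<longlonglongrightarrow> 1 / 27"
proof -
  let ?d = "\<lambda>K c. (node K + real K + c) / real K" and ?e = "\<lambda>K c. (node K + c) / real K"
  have d: "(\<lambda>K. ?d K c) \<longlonglongrightarrow> 3 / 2" and e: "(\<lambda>K. ?e K c) \<longlonglongrightarrow> 1 / 2" for c
    using tendsto_over_n_linear[OF tendsto_node[of 0], of 1 1 c]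
      tendsto_over_n_linear[OF tendsto_node[of 0], of 1 0 c] by simp_all
  have "(\<lambda>K. ?e K 1 * ?e K (1 - \<alpha>) * ?e K (1 - \<beta>) / (?d K (\<gamma> + 2) * ?d K (\<gamma> + 3) * ?d K (\<gamma> + 4)))
      \<longlonglongrightarrow> 1/2 * (1/2) * (1/2) / (3/2 * (3/2) * (3/2))"
    by (intro tendsto_divide tendsto_mult d e) simp
  moreover have "\<forall>\<^sub>F K in sequentially.
      ?e K 1 * ?e K (1 - \<alpha>) * ?e K (1 - \<beta>) / (?d K (\<gamma> + 2) * ?d K (\<gamma> + 3) * ?d K (\<gamma> + 4)) = P (K + 2) K"
    using eventually_gt_at_top[of 0]
  proof eventually_elim
    case (elim K)
    let ?s = "node K + real K + (\<gamma> + 2)"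
    have "?s > 0" using node_gt[of K] gt(3) elim by simp
    have "(node K + 1) * (node K + (1 - \<alpha>)) * (node K + (1 - \<beta>)) = P (K + 2) K * (?s * (?s + 1) * (?s + 2))"
      using band_identity[of K "node K"] by (simp add: poly_q_node algebra_simps)
    then have "P (K + 2) K = (node K + 1) * (node K + (1 - \<alpha>)) * (node K + (1 - \<beta>)) / (?s * (?s + 1) * (?s + 2))"
      using \<open>?s > 0\<close> by simp
    then show ?case using elim by (simp add: add_ac)
  qed
  ultimately show ?thesis by (simp add: filterlim_cong)
qed

text \<open>At \<open>s = - \<gamma> - 4 - K\<close> the factor \<open>\<sigma> + 2\<close>
  vanishes, which removes the other three entries. The limit is the cube of 1 / (3/2).\<close>

lemma P_limit_upper: "(\<lambda>K. P (K + 2) (K + 3)) \<longlonglongrightarrow> 8 / 27"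
proof -
  let ?d = "\<lambda>K i. (node (K + i) + real K + (\<gamma> + 4)) / real K" and ?e = "\<lambda>K c. (real K + c) / real K"
  have d: "(\<lambda>K. ?d K i) \<longlonglongrightarrow> 3 / 2" for i
    using tendsto_over_n_linear[OF tendsto_node[of i], of 1 1 "\<gamma> + 4"] by simp
  have e: "(\<lambda>K. ?e K c) \<longlonglongrightarrow> 1" for c
    using tendsto_over_n_linear[OF tendsto_node[of 0], of 0 1 c] by simp
  have "(\<lambda>K. ?e K (\<gamma> + 3) * ?e K (\<gamma> + 3 + \<alpha>) * ?e K (\<gamma> + 3 + \<beta>) / (?d K 0 * ?d K 1 * ?d K 2))
      \<longlonglongrightarrow> 1 * 1 * 1 / (3/2 * (3/2) * (3/2))"
    by (intro tendsto_divide tendsto_mult d e) simp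
  moreover have "\<forall>\<^sub>F K in sequentially.
      ?e K (\<gamma> + 3) * ?e K (\<gamma> + 3 + \<alpha>) * ?e K (\<gamma> + 3 + \<beta>) / (?d K 0 * ?d K 1 * ?d K 2) = P (K + 2) (K + 3)"
    using eventually_gt_at_top[of 0]
  proof eventually_elim
    case (elim K)
    let ?s = "- \<gamma> - 4 - real K"
    let ?n = "\<lambda>i. node (K + i) + real K + (\<gamma> + 4)"
    have n: "?n i > 0" for i using node_gt[of "K + i"] gt(3) elim by simp
    have "poly (q K) ?s \<noteq> 0" using gt(3) by (intro poly_q_neg_nonzero) simp
    from band_identity[OF this]
    have "(?s + 1) * (?s + 1 - \<alpha>) * (?s + 1 - \<beta>) =
        P (K + 2) (K + 3) * (?s - node K) * (?s - node (K + 1)) * (?s - node (K + 2))" by simp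
    then have "(real K + (\<gamma> + 3)) * (real K + (\<gamma> + 3 + \<alpha>)) * (real K + (\<gamma> + 3 + \<beta>)) =
        P (K + 2) (K + 3) * (?n 0 * ?n 1 * ?n 2)" by (simp add: algebra_simps)
    then have "P (K + 2) (K + 3) =
        (real K + (\<gamma> + 3)) * (real K + (\<gamma> + 3 + \<alpha>)) * (real K + (\<gamma> + 3 + \<beta>)) / (?n 0 * ?n 1 * ?n 2)"
      using n[of 0] n[of 1] n[of 2] by simp
    then show ?case using elim by (simp add: add_ac)
  qed
  ultimately show ?thesis by (simp add: filterlim_cong)
qed

text \<open>At \<open>s = -1\<close> the left side vanishes. Together with the row sum this is a
  linear system for the two middle entries; \<open>?g\<close> is its solution for the diagonal
  one.\<close>

lemma P_limit_diagonal: "(\<lambda>K. P (K + 2) (K + 2)) \<longlonglongrightarrow> 4 / 9"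
proof -
  let ?d = "\<lambda>K c. (real K + c) / real K" and ?e = "\<lambda>K i. (node (K + i) + 1) / real K"
  define c0 where "c0 K = ?d K (\<gamma> + 1) * ?d K (\<gamma> + 2) * ?d K (\<gamma> + 3)" for K
  define c1 where "c1 K = ?d K (\<gamma> + 2) * ?d K (\<gamma> + 3) * ?e K 0" for K
  define c2 where "c2 K = ?d K (\<gamma> + 3) * ?e K 0 * ?e K 1" for K
  define c3 where "c3 K = ?e K 0 * ?e K 1 * ?e K 2" for K
  have e: "(\<lambda>K. ?e K i) \<longlonglongrightarrow> 1 / 2" for i
    using tendsto_over_n_linear[OF tendsto_node[of i], of 1 0 1] by simp
  have d: "(\<lambda>K. ?d K c) \<longlonglongrightarrow> 1" for c
    using tendsto_over_n_linear[OF tendsto_node[of 0], of 0 1 c] by simp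
  have c: "c0 \<longlonglongrightarrow> 1 * 1 * 1" "c1 \<longlonglongrightarrow> 1 * 1 * (1/2)" "c2 \<longlonglongrightarrow> 1 * (1/2) * (1/2)"
      "c3 \<longlonglongrightarrow> 1/2 * (1/2) * (1/2)"
    unfolding c0_def c1_def c2_def c3_def by (intro tendsto_mult d e)+
  let ?g = "\<lambda>K. (c3 K * P (K + 2) (K + 3) - c0 K * P (K + 2) K +
      c1 K * (1 - P (K + 2) K - P (K + 2) (K + 3))) / (c1 K + c2 K)"
  have "?g \<longlonglongrightarrow> (1/2 * (1/2) * (1/2) * (8 / 27) - 1 * 1 * 1 * (1 / 27) +
      1 * 1 * (1/2) * (1 - 1 / 27 - 8 / 27)) / (1 * 1 * (1/2) + 1 * (1/2) * (1/2))"
    by (intro tendsto_intros c P_limit_lower2 P_limit_upper) simp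
  moreover have "\<forall>\<^sub>F K in sequentially. ?g K = P (K + 2) (K + 2)"
    using eventually_gt_at_top[of 0]
  proof eventually_elim
    case (elim K)
    have "?d K (\<gamma> + 2) > 0" "?d K (\<gamma> + 3) > 0"
      using gt(3) elim by (simp_all add: zero_less_divide_iff)
    moreover have "?e K i > 0" for i
      using node_gt[of "K + i"] elim by simp
    ultimately have pos: "c1 K + c2 K > 0"
      unfolding c1_def c2_def by (intro add_pos_pos mult_pos_pos)
    have "P (K + 2) K * (real K + (\<gamma> + 1)) * (real K + (\<gamma> + 2)) * (real K + (\<gamma> + 3))
        - P (K + 2) (K + 1) * (real K + (\<gamma> + 2)) * (real K + (\<gamma> + 3)) * (node K + 1)
        + P (K + 2) (K + 2) * (real K + (\<gamma> + 3)) * (node K + 1) * (node (K + 1) + 1)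
        - P (K + 2) (K + 3) * (node K + 1) * (node (K + 1) + 1) * (node (K + 2) + 1) = 0" (is "?E = 0")
      using band_identity[of K "-1"] poly_q_neg_nonzero[of "-1" K] by (simp add: algebra_simps)
    \<comment> \<open>Each term is a product of three linear factors, so division by the cube gives
      every factor a finite limit.\<close>
    then have "?E / real K ^ 3 = 0" by simp
    also have "?E / real K ^ 3 = P (K + 2) K * c0 K - P (K + 2) (K + 1) * c1 K + P (K + 2) (K + 2) * c2 K
        - P (K + 2) (K + 3) * c3 K"
    proof -
      have scale: "x / real K * (y / real K) * (z / real K) = x * y * z / real K ^ 3" for x y z
        by (simp add: power3_eq_cube)
      show ?thesis
        unfolding c0_def c1_def c2_def c3_def scale
        by (simp only: add_divide_distrib diff_divide_distrib times_divide_eq_right mult_ac add_0_right)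
    qed
    also have "P (K + 2) (K + 1) = 1 - P (K + 2) K - P (K + 2) (K + 2) - P (K + 2) (K + 3)"
      using P_band_sum[of K] by simp
    finally have "P (K + 2) (K + 2) * (c1 K + c2 K) = c3 K * P (K + 2) (K + 3) - c0 K * P (K + 2) K +
      c1 K * (1 - P (K + 2) K - P (K + 2) (K + 3))" by algebra
    then show ?case using pos by (simp add: divide_eq_eq)
  qed
  ultimately show ?thesis by (simp add: filterlim_cong)
qed

lemma P_limit_lower1: "(\<lambda>K. P (K + 2) (K + 1)) \<longlonglongrightarrow> 2 / 9"
proof -
  have "(\<lambda>K. 1 - P (K + 2) K - P (K + 2) (K + 2) - P (K + 2) (K + 3)) \<longlonglongrightarrow> 1 - 1 / 27 - 4 / 9 - 8 / 27"
    by (intro tendsto_intros P_limit_lower2 P_limit_diagonal P_limit_upper)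
  moreover have "1 - P (K + 2) K - P (K + 2) (K + 2) - P (K + 2) (K + 3) = P (K + 2) (K + 1)" for K
    using P_band_sum[of K] by simp
  ultimately show ?thesis by simp
qed

end

section \<open>Passage to even and odd rows\<close>

theorem corollary8:
  fixes \<alpha> \<beta> \<gamma> :: real
  assumes "\<alpha> > -1" and "\<beta> > -1" and "\<gamma> > -1"
    and "\<alpha> \<noteq> \<beta>" and "\<bar>\<alpha> - \<beta>\<bar> < 1"
  shows "((\<lambda>n. P_II \<alpha> \<beta> \<gamma> (2 * n + 1) (2 * n + 2)) \<longlonglongrightarrow> 8 / 27) \<and>
    ((\<lambda>n. P_II \<alpha> \<beta> \<gamma> (2 * n) (2 * n + 1)) \<longlonglongrightarrow> 8 / 27) \<and>
    ((\<lambda>n. P_II \<alpha> \<beta> \<gamma> (2 * n + 1) (2 * n + 1)) \<longlonglongrightarrow> 4 / 9) \<and>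
    ((\<lambda>n. P_II \<alpha> \<beta> \<gamma> (2 * n) (2 * n)) \<longlonglongrightarrow> 4 / 9) \<and>
    ((\<lambda>n. P_II \<alpha> \<beta> \<gamma> (2 * n + 1) (2 * n)) \<longlonglongrightarrow> 2 / 9) \<and>
    ((\<lambda>n. P_II \<alpha> \<beta> \<gamma> (2 * n) (2 * n - 1)) \<longlonglongrightarrow> 2 / 9) \<and>
    ((\<lambda>n. P_II \<alpha> \<beta> \<gamma> (2 * n + 1) (2 * n - 1)) \<longlonglongrightarrow> 1 / 27) \<and>
    ((\<lambda>n. P_II \<alpha> \<beta> \<gamma> (2 * n) (2 * n - 2)) \<longlonglongrightarrow> 1 / 27)"
proof -
  interpret jacobi_pineiro_params \<alpha> \<beta> \<gamma>
    using assms by unfold_locales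
  have sub: "strict_mono (\<lambda>n::nat. 2 * n)" "strict_mono (\<lambda>n::nat. 2 * n + 1)"
    by (auto simp: strict_mono_def)
  \<comment> \<open>An offset does not change the limit, and both parities are subsequences.\<close>
  have lim: "(\<lambda>n. f (2 * n + 1)) \<longlonglongrightarrow> L \<and> (\<lambda>n. f (2 * n)) \<longlonglongrightarrow> L"
    if "(\<lambda>K. f (K + 2)) \<longlonglongrightarrow> L" for f :: "nat \<Rightarrow> real" and L
  proof -
    have "f \<longlonglongrightarrow> L" using that by (rule LIMSEQ_offset)
    then show ?thesis using LIMSEQ_subseq_LIMSEQ sub by (fastforce simp: o_def)
  qed
  \<comment> \<open>In row \<open>k = K + 2\<close> the natural-number differences
    \<open>k - 1\<close> and \<open>k - 2\<close> are genuine; truncation affects only rows below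
    2.\<close>
  show ?thesis
    using lim[of "\<lambda>k. P k (k + 1)" "8 / 27"] lim[of "\<lambda>k. P k k" "4 / 9"]
      lim[of "\<lambda>k. P k (k - 1)" "2 / 9"] lim[of "\<lambda>k. P k (k - 2)" "1 / 27"]
      P_limit_upper P_limit_diagonal P_limit_lower1 P_limit_lower2
    by (simp add: numeral_3_eq_3)
qed

end
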